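(* Let $E$ be any expression. Then: (i) For all $k\geq 1$, $$R_{k;E}(x)=\frac{U_{k-1}\left(\frac{1}{2\sqrt{x}}\right)-\sqrt{x}\,E\cdot U_{k-2}\left(\frac{1}{2\sqrt{x}}\right)}{\sqrt{x}\left( U_k\left(\frac{1}{2\sqrt{x}}\right)-\sqrt{x}\,E\cdot U_{k-1}\left(\frac{1}{2\sqrt{x}}\right)\right)},$$ where $U_k$ is the $k$th Chebyshev polynomial of the second kind. (ii) For all $k\geq 1$, $$\prod_{j=1}^k R_{j;E}(x)=\frac{1}{x^{\frac{k}{2}}\left[ U_k\left(\frac{1}{2\sqrt{x}}\right) -\sqrt{x}\,E\cdot U_{k-1}\left(\frac{1}{2\sqrt{x}}\right) \right]},$$ where $U_k$ is the $k$th Chebyshev polynomial of the second kind. (iii) $$\lim_{k\rightarrow\infty} R_{k;E}(x)=\frac{1-\sqrt{1-4x}}{2x}.$$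
   Context: For $k\geq 1$, $R_{k;E}(x)$ denotes the continued fraction with $k$ steps $$\frac{1}{1-\frac{x}{1-\ddots\frac{x}{1-xE}}},$$ and for $k=0$, $R_{0;E}(x)=E$. Thus $R_{1;E}(x)=\frac{1}{1-xE}$ and $R_{k+1;E}(x)=\frac{1}{1-xR_{k;E}(x)}$ for $k\geq 0$. The Chebyshev polynomials of the second kind $U_m$ are given by $U_m(\cos\theta)=\frac{\sin((m+1)\theta)}{\sin\theta}$; they satisfy $U_m(t)=2tU_{m-1}(t)-U_{m-2}(t)$, with $U_0(t)=1$ and $U_{-1}(t)=0$.
   Formalization: In (iii), E is taken to be a formal power series in x and the limit is coefficientwise, since the claim fails for E = (1+√(1−4x))/(2x), where every R_{k;E} equals E; in (i) and (ii), x is nonzero and the continued fraction is assumed to be defined. *)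

theory Defs
  imports "HOL-Computational_Algebra.Computational_Algebra" Complex_Main
begin

text \<open>
  The index is an integer so that the value \<open>U\<^sub>-\<^sub>1 = 0\<close> is available. The auxiliary
  sequence is shifted by one: \<open>cheb_U_shift n\<close> is \<open>U\<^sub>n\<^sub>-\<^sub>1\<close>. Indices below \<open>-1\<close> are junk.
\<close>
fun cheb_U_shift :: "nat \<Rightarrow> 'a::comm_ring_1 poly" where
  "cheb_U_shift 0 = 0"
| "cheb_U_shift (Suc 0) = 1"
| "cheb_U_shift (Suc (Suc n)) = [:0, 2:] * cheb_U_shift (Suc n) - cheb_U_shift n"

definition cheb_U :: "int \<Rightarrow> 'a::comm_ring_1 poly" where
  "cheb_U m = cheb_U_shift (nat (m + 1))"

lemma cheb_U_minus_1: "cheb_U (-1) = 0"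
  and cheb_U_0: "cheb_U 0 = 1"
  by (simp_all add: cheb_U_def)

lemma cheb_U_rec:
  assumes "m \<ge> 1"
  shows "cheb_U m = [:0, 2:] * cheb_U (m - 1) - cheb_U (m - 2)"
proof -
  obtain n where "m = int n + 1"
    using assms by (metis zle_iff_zadd add.commute)
  moreover have "nat (2 + int n) = Suc (Suc n)" "nat (1 + int n) = Suc n" by simp_all
  ultimately show ?thesis by (simp add: cheb_U_def add_ac)
qed

text \<open>The recursion agrees with the trigonometric definition.\<close>
lemma cheb_U_cos:
  fixes \<theta> :: real
  assumes "m \<ge> -1" and "sin \<theta> \<noteq> 0"
  shows "poly (cheb_U m) (cos \<theta>) = sin ((of_int m + 1) * \<theta>) / sin \<theta>"
proof -
  have *: "poly (cheb_U_shift n) (cos \<theta>) * sin \<theta> = sin (real n * \<theta>)" for n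
  proof (induction n rule: cheb_U_shift.induct)
    case (3 n)
    have "sin (real (Suc (Suc n)) * \<theta>) = sin (real (Suc n) * \<theta> + \<theta>)"
      by (simp add: algebra_simps)
    moreover have "sin (real n * \<theta>) = sin (real (Suc n) * \<theta> - \<theta>)"
      by (simp add: algebra_simps)
    ultimately have "sin (real (Suc (Suc n)) * \<theta>)
        = 2 * cos \<theta> * sin (real (Suc n) * \<theta>) - sin (real n * \<theta>)"
      by (simp add: sin_add sin_diff)
    with 3 show ?case by (simp add: algebra_simps)
  qed simp_all
  have "real (nat (m + 1)) = of_int m + 1" using assms(1) by simp
  with *[of "nat (m + 1)"] assms(2) show ?thesis
    by (simp add: cheb_U_def field_simps)
qed

text \<open>
  \<open>cfrac x E k\<close> is the continued fraction \<open>R\<^sub>k\<^sub>;\<^sub>E(x)\<close>. It is used both in fields and in the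
  ring of formal power series over a field. It is meaningful up to step \<open>k\<close> whenever none of
  the denominators \<open>1 - x * cfrac x E j\<close> with \<open>j < k\<close> vanishes (in a field), respectively
  all of them are units (for power series).
\<close>
fun cfrac :: "'a::{one,minus,times,inverse} \<Rightarrow> 'a \<Rightarrow> nat \<Rightarrow> 'a" where
  "cfrac x E 0 = E"
| "cfrac x E (Suc k) = 1 / (1 - x * cfrac x E k)"

lemma cfrac_fps_X:
  fixes E :: "'a::field fps"
  shows "cfrac fps_X E (Suc k) * (1 - fps_X * cfrac fps_X E k) = 1"
proof -
  have "(1 - fps_X * cfrac fps_X E k) $ 0 \<noteq> 0" by simp
  then show ?thesis
    by (simp add: fps_divide_unit inverse_mult_eq_1)
qed

text \<open>
  In the field of Laurent series in a variable standing for the square root of \<open>x\<close>,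
  a power series \<open>E\<close> in that variable never makes a denominator vanish.
\<close>
lemma cfrac_fls_denominator_nonzero:
  fixes E :: "'a::field fps"
  shows "1 - fls_X ^ 2 * cfrac (fls_X ^ 2) (fps_to_fls E) k \<noteq> 0"
proof -
  have nz: "1 - fls_X ^ 2 * fps_to_fls F = fps_to_fls (1 - fps_X ^ 2 * F)"
    and nz0: "(1 - fps_X ^ 2 * F) $ 0 \<noteq> 0" for F :: "'a fps"
    by (simp_all add: fls_times_fps_to_fls fps_to_fls_power)
  have "\<exists>F. cfrac (fls_X ^ 2) (fps_to_fls E) k = fps_to_fls F"
  proof (induction k)
    case (Suc k)
    then obtain F where F: "cfrac (fls_X ^ 2) (fps_to_fls E) k = fps_to_fls F" by blast
    have "fps_to_fls (inverse (1 - fps_X ^ 2 * F)) * fps_to_fls (1 - fps_X ^ 2 * F) = 1"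
      unfolding fls_times_fps_to_fls[symmetric] inverse_mult_eq_1[OF nz0] by simp
    then have "1 / fps_to_fls (1 - fps_X ^ 2 * F) = fps_to_fls (inverse (1 - fps_X ^ 2 * F))"
      by (metis divide_eq_eq mult_zero_right zero_neq_one)
    then show ?case using F nz by auto
  qed auto
  then obtain F where F: "cfrac (fls_X ^ 2) (fps_to_fls E) k = fps_to_fls F" by blast
  have "1 - fps_X ^ 2 * F \<noteq> 0" using nz0[of F] by force
  then show ?thesis unfolding F nz by simp
qed

text \<open>
  The power series \<open>sqrt (1 - 4 x)\<close>: the square root with constant coefficient 1. The first
  argument of \<^const>\<open>fps_radical\<close> chooses the root of the constant coefficient.
\<close>
definition sqrt_one_minus_4X :: "'a::field_char_0 fps" where
  "sqrt_one_minus_4X = fps_radical (\<lambda>_ _. 1) 2 (1 - 4 * fps_X)"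

lemma sqrt_one_minus_4X_nth_0: "sqrt_one_minus_4X $ 0 = 1"
  by (simp add: sqrt_one_minus_4X_def)

lemma sqrt_one_minus_4X_square:
  "sqrt_one_minus_4X ^ 2 = (1 - 4 * fps_X :: 'a::field_char_0 fps)"
  using power_radical[of "1 - 4 * fps_X :: 'a fps" "\<lambda>_ _. 1" 1]
  by (simp add: sqrt_one_minus_4X_def numeral_2_eq_2 fps_numeral_nth_0)

text \<open>The division by \<open>2 x\<close> of power series is exact.\<close>
lemma one_minus_sqrt_div_exact:
  "(1 - sqrt_one_minus_4X) / (2 * fps_X) * (2 * fps_X) = (1 - sqrt_one_minus_4X :: 'a::field_char_0 fps)"
proof -
  let ?f = "1 - sqrt_one_minus_4X :: 'a fps"
  have "(fps_const (1/2) * fps_shift 1 ?f) * (2 * fps_X)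
      = (fps_const (1/2) * 2) * (fps_shift 1 ?f * fps_X)"
    by (simp only: ac_simps)
  also have "fps_const (1/2) * (2 :: 'a fps) = 1"
    by (simp add: numeral_fps_const)
  also have "fps_shift 1 ?f * fps_X = ?f"
    by (rule fps_ext) (auto simp: fps_X_mult_right_nth sqrt_one_minus_4X_nth_0)
  finally have "?f = (fps_const (1/2) * fps_shift 1 ?f) * (2 * fps_X)"
    by (simp only: mult_1_left)
  then have "2 * fps_X dvd ?f" by (metis dvd_triv_right)
  then show ?thesis by simp
qed

end

theory Submission
  imports Defs
begin

text \<open>
  With \<open>D\<^sub>k = s\<^sup>k (U\<^sub>k - s E U\<^sub>k\<^sub>-\<^sub>1)\<close>, evaluated at \<open>1 / (2 s)\<close> where \<open>s\<^sup>2 = x\<close>, the Chebyshev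
  recurrence becomes \<open>D\<^sub>k\<^sub>+\<^sub>2 = D\<^sub>k\<^sub>+\<^sub>1 - x D\<^sub>k\<close>. Hence \<open>R\<^sub>k\<^sub>+\<^sub>1 = D\<^sub>k / D\<^sub>k\<^sub>+\<^sub>1\<close>, which gives the
  closed form, and the product telescopes. For the limit, \<open>L = (1 - sqrt (1 - 4 x)) / (2 x)\<close> is the
  fixed point of \<open>R \<mapsto> 1 / (1 - x R)\<close>, and
  \<open>R\<^sub>k\<^sub>+\<^sub>1 - L = x L R\<^sub>k\<^sub>+\<^sub>1 (R\<^sub>k - L)\<close>, so \<open>R\<^sub>k - L\<close> is divisible by \<open>x\<^sup>k\<close>.
\<close>

definition cfrac_denom :: "'a::field \<Rightarrow> 'a \<Rightarrow> nat \<Rightarrow> 'a" where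
  "cfrac_denom s E k =
     s ^ k * (poly (cheb_U (int k)) (1 / (2 * s)) - s * E * poly (cheb_U (int k - 1)) (1 / (2 * s)))"

text \<open>At 1/(2s) the coefficient 2t of the recurrence is 1/s, so one factor s clears
  it.\<close>

lemma cheb_U_scaled_rec:
  fixes s :: "'a::field_char_0"
  assumes "s \<noteq> 0" and "m \<ge> 1"
  shows "s * poly (cheb_U m) (1 / (2 * s))
    = poly (cheb_U (m - 1)) (1 / (2 * s)) - s * poly (cheb_U (m - 2)) (1 / (2 * s))"
  using assms by (simp add: cheb_U_rec[OF assms(2)] right_diff_distrib)

lemma cfrac_denom_0 [simp]: "cfrac_denom s E 0 = 1"
  by (simp add: cfrac_denom_def cheb_U_0 cheb_U_minus_1)

lemma cfrac_denom_1:
  fixes s :: "'a::field_char_0"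
  assumes "s \<noteq> 0"
  shows "cfrac_denom s E (Suc 0) = 1 - s ^ 2 * E"
  using cheb_U_scaled_rec[OF assms, of 1]
  by (simp add: cfrac_denom_def cheb_U_0 cheb_U_minus_1 right_diff_distrib power2_eq_square)

lemma cfrac_denom_rec:
  fixes s :: "'a::field_char_0"
  assumes "s \<noteq> 0"
  shows "cfrac_denom s E (Suc (Suc k)) = cfrac_denom s E (Suc k) - s ^ 2 * cfrac_denom s E k"
proof -
  let ?U = "\<lambda>m. poly (cheb_U m) (1 / (2 * s))"
  have U2: "s * ?U (int k + 2) = ?U (int k + 1) - s * ?U (int k)"
    using cheb_U_scaled_rec[OF assms, of "int k + 2"] by (simp add: add.commute)
  \<comment> \<open>The recurrence is just admissible at \<open>k = 0\<close>, where it reaches the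
    value 0 at index -1.\<close>
  have U1: "s * ?U (int k + 1) = ?U (int k) - s * ?U (int k - 1)"
    using cheb_U_scaled_rec[OF assms, of "int k + 1"] by (simp add: add.commute)
  \<comment> \<open>Of the two extra factors s, one goes into the bracket to match \<open>U2\<close>
    and \<open>U1\<close>.\<close>
  have "cfrac_denom s E (Suc (Suc k)) = s * s ^ k * (s * ?U (int k + 2) - s * E * (s * ?U (int k + 1)))"
    by (simp add: cfrac_denom_def algebra_simps)
  also have "\<dots> = cfrac_denom s E (Suc k) - s ^ 2 * cfrac_denom s E k"
    unfolding U2 U1 by (simp add: cfrac_denom_def algebra_simps power2_eq_square)
  finally show ?thesis .
qed

text \<open>In effect D_k is the product of the denominators 1 - x R_j over j < k, hence nonzero.
  The multiplicative form still makes sense when the next factor 1 - x R_k, about which nothing is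
  assumed, vanishes.\<close>

lemma cfrac_denom_Suc:
  fixes s :: "'a::field_char_0"
  assumes "s \<noteq> 0" and "\<forall>j<k. 1 - s ^ 2 * cfrac (s ^ 2) E j \<noteq> 0"
  shows "cfrac_denom s E k \<noteq> 0 \<and>
    cfrac_denom s E (Suc k) = cfrac_denom s E k * (1 - s ^ 2 * cfrac (s ^ 2) E k)"
  using assms(2)
proof (induction k)
  case 0
  then show ?case by (simp add: cfrac_denom_1[OF assms(1)])
next
  case (Suc k)
  have IH: "cfrac_denom s E k \<noteq> 0"
    "cfrac_denom s E (Suc k) = cfrac_denom s E k * (1 - s ^ 2 * cfrac (s ^ 2) E k)"
    using Suc by auto
  have nz: "1 - s ^ 2 * cfrac (s ^ 2) E k \<noteq> 0"
    using Suc.prems by blast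
  \<comment> \<open>This turns the term x D_k of the recurrence into x D_{k+1} R_{k+1}, so that
    D_{k+1} factors out.\<close>
  have "cfrac_denom s E (Suc k) * cfrac (s ^ 2) E (Suc k) = cfrac_denom s E k"
    using nz by (simp add: IH(2))
  then have "cfrac_denom s E (Suc (Suc k))
      = cfrac_denom s E (Suc k) * (1 - s ^ 2 * cfrac (s ^ 2) E (Suc k))"
    unfolding cfrac_denom_rec[OF assms(1)] by (simp add: algebra_simps del: cfrac.simps)
  with IH nz show ?case by simp
qed

lemma cfrac_eq_denom_quotient:
  fixes s :: "'a::field_char_0"
  assumes "s \<noteq> 0" and "\<forall>j<Suc k. 1 - s ^ 2 * cfrac (s ^ 2) E j \<noteq> 0"
  shows "cfrac (s ^ 2) E (Suc k) = cfrac_denom s E k / cfrac_denom s E (Suc k)"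
  using cfrac_denom_Suc[OF assms(1), of k E] assms(2) by (simp add: less_Suc_eq)

lemma prod_cfrac:
  fixes s :: "'a::field_char_0"
  assumes "s \<noteq> 0" and "\<forall>j<k. 1 - s ^ 2 * cfrac (s ^ 2) E j \<noteq> 0"
  shows "(\<Prod>j=1..k. cfrac (s ^ 2) E j) = 1 / cfrac_denom s E k"
  using assms(2)
proof (induction k)
  case (Suc k)
  have "cfrac_denom s E k \<noteq> 0"
    using cfrac_denom_Suc[OF assms(1), of k E] Suc.prems by simp
  moreover have "(\<Prod>j=1..k. cfrac (s ^ 2) E j) = 1 / cfrac_denom s E k"
    using Suc by simp
  ultimately show ?case
    using cfrac_eq_denom_quotient[OF assms(1) Suc.prems] by (simp del: cfrac.simps)
qed simp

lemma cfrac_chebyshev: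
  fixes s :: "'a::field_char_0"
  assumes "s \<noteq> 0" and "k \<ge> 1" and "\<forall>j<k. 1 - s ^ 2 * cfrac (s ^ 2) E j \<noteq> 0"
  shows "cfrac (s ^ 2) E k =
    (poly (cheb_U (int k - 1)) (1 / (2 * s)) - s * E * poly (cheb_U (int k - 2)) (1 / (2 * s)))
    / (s * (poly (cheb_U (int k)) (1 / (2 * s)) - s * E * poly (cheb_U (int k - 1)) (1 / (2 * s))))"
    (is "_ = ?N / (s * ?M)")
proof -
  obtain m where k: "k = Suc m"
    using assms(2) by (cases k) auto
  have "cfrac (s ^ 2) E k = cfrac_denom s E m / cfrac_denom s E k"
    using cfrac_eq_denom_quotient[OF assms(1)] assms(3) unfolding k by blast
  also have "cfrac_denom s E m = s ^ m * ?N"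
    by (simp add: cfrac_denom_def k)
  \<comment> \<open>The one power of s by which the two scalings differ is the lone s of the closed
    form.\<close>
  also have "cfrac_denom s E k = s ^ m * (s * ?M)"
    by (simp add: cfrac_denom_def k)
  also have "s ^ m * ?N / (s ^ m * (s * ?M)) = ?N / (s * ?M)"
    using assms(1) by simp
  finally show ?thesis .
qed

lemma one_minus_sqrt_div_fixed_point:
  fixes L :: "'a::field_char_0 fps"
  defines "L \<equiv> (1 - sqrt_one_minus_4X) / (2 * fps_X)"
  shows "L * (1 - fps_X * L) = 1"
proof -
  let ?S = "sqrt_one_minus_4X :: 'a fps"
  have L: "L * (2 * fps_X) = 1 - ?S"
    unfolding L_def by (rule one_minus_sqrt_div_exact)
  \<comment> \<open>The factor 4x leaves only y = 2xL = 1 - \<open>?S\<close>, and 2y - y^2 = 1 - (1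
    - y)^2. It is nonzero in characteristic 0 and is cancelled at the end.\<close>
  have "4 * fps_X * (L * (1 - fps_X * L)) = 2 * (L * (2 * fps_X)) - (L * (2 * fps_X)) ^ 2"
    by (simp add: algebra_simps power2_eq_square)
  also have "\<dots> = 1 - ?S ^ 2"
    unfolding L by (simp add: algebra_simps power2_eq_square)
  also have "\<dots> = 4 * fps_X * 1"
    by (simp add: sqrt_one_minus_4X_square)
  finally show ?thesis
    by (subst (asm) mult_left_cancel) auto
qed

lemma fps_X_power_dvd_cfrac_diff:
  fixes E L :: "'a::field fps"
  assumes L: "L * (1 - fps_X * L) = 1"
  shows "fps_X ^ k dvd cfrac fps_X E k - L"
proof (induction k)
  case (Suc k)
  let ?R = "cfrac fps_X E k" and ?R' = "cfrac fps_X E (Suc k)"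
  \<comment> \<open>Both inserted factors equal 1; expanding, the two products
    \<open>?R' * L\<close> cancel and a factor x remains.\<close>
  have "?R' - L = ?R' * (L * (1 - fps_X * L)) - L * (?R' * (1 - fps_X * ?R))"
    unfolding L cfrac_fps_X by simp
  also have "\<dots> = (fps_X * (?R - L)) * (?R' * L)"
    by (simp add: algebra_simps del: cfrac.simps)
  finally show ?case
    using Suc by (metis dvd_mult2 mult_dvd_mono dvd_refl power_Suc)
qed simp

text \<open>Convergence of power series is coefficientwise: coefficient n is stable once k >
  n.\<close>

lemma tendsto_fps_if_X_power_dvd:
  fixes f :: "nat \<Rightarrow> 'a::comm_ring_1 fps"
  assumes "\<And>k. fps_X ^ k dvd f k - g"
  shows "f \<longlonglongrightarrow> g"
proof (rule tendsto_fpsI)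
  fix n
  show "\<forall>\<^sub>F k in sequentially. f k $ n = g $ n"
    using eventually_gt_at_top[of n]
  proof eventually_elim
    case (elim k)
    obtain h where "f k - g = fps_X ^ k * h"
      using assms[of k] by (elim dvdE)
    then have "(f k - g) $ n = 0"
      using elim by (simp add: fps_X_power_mult_nth)
    then show ?case by simp
  qed
qed

text \<open>The nonvanishing conclusions ensure that neither closed form rests on the convention
  that division by zero gives 0.\<close>

theorem proposition1:
  shows
    "(\<forall>(x::'f::field_char_0) s E k. x \<noteq> 0 \<longrightarrow> s ^ 2 = x \<longrightarrow> k \<ge> 1 \<longrightarrow>
        (\<forall>j<k. 1 - x * cfrac x E j \<noteq> 0) \<longrightarrow>
        s * (poly (cheb_U (int k)) (1 / (2 * s))
             - s * E * poly (cheb_U (int k - 1)) (1 / (2 * s))) \<noteq> 0 \<and>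
        cfrac x E k =
          (poly (cheb_U (int k - 1)) (1 / (2 * s))
             - s * E * poly (cheb_U (int k - 2)) (1 / (2 * s)))
          / (s * (poly (cheb_U (int k)) (1 / (2 * s))
             - s * E * poly (cheb_U (int k - 1)) (1 / (2 * s))))) \<and>
     (\<forall>(x::'f::field_char_0) s E k. x \<noteq> 0 \<longrightarrow> s ^ 2 = x \<longrightarrow> k \<ge> 1 \<longrightarrow>
        (\<forall>j<k. 1 - x * cfrac x E j \<noteq> 0) \<longrightarrow>
        s ^ k * (poly (cheb_U (int k)) (1 / (2 * s))
             - s * E * poly (cheb_U (int k - 1)) (1 / (2 * s))) \<noteq> 0 \<and>
        (\<Prod>j=1..k. cfrac x E j) =
          1 / (s ^ k * (poly (cheb_U (int k)) (1 / (2 * s))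
             - s * E * poly (cheb_U (int k - 1)) (1 / (2 * s))))) \<and>
     (\<forall>E :: 'a::field_char_0 fps.
        (\<lambda>k. cfrac fps_X E k) \<longlonglongrightarrow> (1 - sqrt_one_minus_4X) / (2 * fps_X))"
proof (intro conjI allI impI)
  fix x s E :: 'f and k :: nat
  assume x: "x \<noteq> 0" and s: "s ^ 2 = x" and k: "k \<ge> 1"
    and nz: "\<forall>j<k. 1 - x * cfrac x E j \<noteq> 0"
  have s0: "s \<noteq> 0" using x s by auto
  note nz' = nz[folded s]
  have D: "cfrac_denom s E k \<noteq> 0"
    using cfrac_denom_Suc[OF s0 nz'] by blast
  then show "s ^ k * (poly (cheb_U (int k)) (1 / (2 * s))
      - s * E * poly (cheb_U (int k - 1)) (1 / (2 * s))) \<noteq> 0"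
    by (simp only: cfrac_denom_def not_False_eq_True)
  from D s0 show "s * (poly (cheb_U (int k)) (1 / (2 * s))
      - s * E * poly (cheb_U (int k - 1)) (1 / (2 * s))) \<noteq> 0"
    by (simp add: cfrac_denom_def)
  show "cfrac x E k =
      (poly (cheb_U (int k - 1)) (1 / (2 * s)) - s * E * poly (cheb_U (int k - 2)) (1 / (2 * s)))
      / (s * (poly (cheb_U (int k)) (1 / (2 * s)) - s * E * poly (cheb_U (int k - 1)) (1 / (2 * s))))"
    using cfrac_chebyshev[OF s0 k nz'] unfolding s .
  show "(\<Prod>j=1..k. cfrac x E j) =
      1 / (s ^ k * (poly (cheb_U (int k)) (1 / (2 * s))
        - s * E * poly (cheb_U (int k - 1)) (1 / (2 * s))))"
    using prod_cfrac[OF s0 nz'] unfolding s cfrac_denom_def .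
next
  fix E :: "'a fps"
  show "(\<lambda>k. cfrac fps_X E k) \<longlonglongrightarrow> (1 - sqrt_one_minus_4X) / (2 * fps_X)"
    by (intro tendsto_fps_if_X_power_dvd fps_X_power_dvd_cfrac_diff one_minus_sqrt_div_fixed_point)
qed

end
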